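(* Let $\mathcal{A}$ be a Leibniz algebra over a field $F$ of characteristic zero and let $B, C$ be two subinvariant subalgebras of $\mathcal{A}$. Then the subalgebra $D$ generated by $B$ and $C$ is a subinvariant subalgebra of $\mathcal{A}$.
   Context: A Leibniz algebra over a field $F$ means a finite-dimensional left Leibniz algebra: a finite-dimensional $F$-vector space with a bilinear product $(x,y)\mapsto xy$ such that $x(yz) = (xy)z + y(xz)$ for all $x,y,z$. Ideals are two-sided; $I \vartriangleleft J$ means $I$ is an ideal of $J$. A subalgebra $B$ of $\mathcal{A}$ is subinvariant in $\mathcal{A}$ if there is a chain of subalgebras $B = B_t \subset B_{t-1} \subset \cdots \subset B_0 = \mathcal{A}$ with $B_i \vartriangleleft B_{i-1}$ for all $1 \leq i \leq t$. *)

theory Defs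
  imports Complex_Main
begin

locale leibniz_algebra = vector_space scale
  for scale :: "'f::field \<Rightarrow> 'v::ab_group_add \<Rightarrow> 'v" (infixr "*s" 75) +
  fixes mul :: "'v \<Rightarrow> 'v \<Rightarrow> 'v" (infixl "\<cdot>" 70)
  assumes finite_dimensional: "\<exists>Basis. finite_dimensional_vector_space scale Basis"
    and linear_left: "Vector_Spaces.linear scale scale (\<lambda>x. x \<cdot> y)"
    and linear_right: "Vector_Spaces.linear scale scale (\<lambda>y. x \<cdot> y)"
    and leibniz: "x \<cdot> (y \<cdot> z) = (x \<cdot> y) \<cdot> z + y \<cdot> (x \<cdot> z)"
begin

definition subalgebra :: "'v set \<Rightarrow> bool"
  where "subalgebra S \<longleftrightarrow> subspace S \<and> (\<forall>x\<in>S. \<forall>y\<in>S. x \<cdot> y \<in> S)"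

definition ideal_of :: "'v set \<Rightarrow> 'v set \<Rightarrow> bool"
  where "ideal_of I J \<longleftrightarrow>
    subspace I \<and> I \<subseteq> J \<and> (\<forall>a\<in>I. \<forall>x\<in>J. a \<cdot> x \<in> I \<and> x \<cdot> a \<in> I)"

text \<open>
  The ambient algebra is the whole type. Inclusions in the chain need not be strict, and \<open>t = 0\<close>
  is allowed, so the algebra is subinvariant in itself.
\<close>

definition subinvariant :: "'v set \<Rightarrow> bool"
  where "subinvariant B \<longleftrightarrow>
    (\<exists>(t::nat) (c :: nat \<Rightarrow> 'v set). c t = B \<and> c 0 = UNIV \<and>
      (\<forall>i\<le>t. subalgebra (c i)) \<and> (\<forall>i\<in>{1..t}. ideal_of (c i) (c (i - 1))))"

definition generated_subalgebra :: "'v set \<Rightarrow> 'v set"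
  where "generated_subalgebra X = subalgebra hull X"

end

end

theory Submission
  imports Defs "HOL-Library.Set_Algebras"
begin

text \<open>
  The nilpotent residuals of \<open>B\<close> and \<open>C\<close> are ideals of the whole algebra; let \<open>K\<close> be their sum. Modulo
  \<open>K\<close> the left multiplications by \<open>B\<close> generate a nilpotent ring. For a chain from \<open>B\<close> up to the whole
  algebra, consider the associative rings generated by the left multiplications of its members. In
  characteristic zero the largest nilpotent ideal modulo \<open>K\<close> of such a ring is stable under every
  commutator that preserves the ring, hence contained in the corresponding ideal of the next ring.
  Therefore \<open>B\<close> and likewise \<open>C\<close> lie in an ideal \<open>N\<close> of the algebra that is nilpotent modulo \<open>K\<close>.
  The subalgebra \<open>D\<close> they generate satisfies \<open>K \<subseteq> D \<subseteq> N\<close>, and adding \<open>D\<close> to the terms of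
  the lower central series of \<open>N\<close> yields a chain from \<open>N\<close> down to \<open>D\<close>.
\<close>

section \<open>The nilpotent radical of a ring modulo an ideal\<close>

text \<open>Closure under differences yields negatives and sums at once; \<open>0\<close> is listed
  separately so that the closure of the empty set is a subgroup too.\<close>

inductive_set additive_closure :: "'a::ab_group_add set \<Rightarrow> 'a set" for X
  where
    additive_closure_zero: "0 \<in> additive_closure X"
  | additive_closure_base: "a \<in> X \<Longrightarrow> a \<in> additive_closure X"
  | additive_closure_diff:
      "a \<in> additive_closure X \<Longrightarrow> b \<in> additive_closure X \<Longrightarrow> a - b \<in> additive_closure X"

inductive_set generated_ring :: "'a::{ring, monoid_mult} set \<Rightarrow> 'a set" for X
  where
    generated_ring_one: "1 \<in> generated_ring X"
  | generated_ring_base: "a \<in> X \<Longrightarrow> a \<in> generated_ring X"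
  | generated_ring_diff:
      "a \<in> generated_ring X \<Longrightarrow> b \<in> generated_ring X \<Longrightarrow> a - b \<in> generated_ring X"
  | generated_ring_mult:
      "a \<in> generated_ring X \<Longrightarrow> b \<in> generated_ring X \<Longrightarrow> a * b \<in> generated_ring X"

definition unital_subring :: "'a::{ring, monoid_mult} set \<Rightarrow> bool"
  where "unital_subring E \<longleftrightarrow> 1 \<in> E \<and> (\<forall>a\<in>E. \<forall>b\<in>E. a - b \<in> E \<and> a * b \<in> E)"

definition ideal_in :: "'a::{ring, monoid_mult} set \<Rightarrow> 'a set \<Rightarrow> bool"
  where "ideal_in E R \<longleftrightarrow> R \<subseteq> E \<and> 0 \<in> R \<and> (\<forall>a\<in>R. \<forall>b\<in>R. a - b \<in> R) \<and>
    (\<forall>e\<in>E. \<forall>a\<in>R. e * a \<in> R \<and> a * e \<in> R)"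

text \<open>The sort \<open>{ring, monoid_mult}\<close> lacks \<open>of_nat\<close>, because it admits the trivial ring.\<close>

definition nat_elt :: "nat \<Rightarrow> 'a::{ring, monoid_mult}"
  where "nat_elt n = (\<Sum>i<n. 1)"

abbreviation commutator :: "'a::ring \<Rightarrow> 'a \<Rightarrow> 'a"
  where "commutator x a \<equiv> x * a - a * x"

lemma diff_closed_add:
  fixes R :: "'a::ab_group_add set"
  assumes "0 \<in> R" and "\<And>a b. a \<in> R \<Longrightarrow> b \<in> R \<Longrightarrow> a - b \<in> R" and "a \<in> R" and "b \<in> R"
  shows "a + b \<in> R"
proof -
  have "a - (0 - b) \<in> R" using assms by blast
  then show ?thesis by simp
qed

lemma unital_subringD:
  assumes "unital_subring E"
  shows "1 \<in> E" and "0 \<in> E" and "\<And>a b. a \<in> E \<Longrightarrow> b \<in> E \<Longrightarrow> a - b \<in> E"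
    and "\<And>a b. a \<in> E \<Longrightarrow> b \<in> E \<Longrightarrow> a * b \<in> E"
    and "\<And>a b. a \<in> E \<Longrightarrow> b \<in> E \<Longrightarrow> a + b \<in> E"
proof -
  show *: "1 \<in> E" "\<And>a b. a \<in> E \<Longrightarrow> b \<in> E \<Longrightarrow> a - b \<in> E"
    "\<And>a b. a \<in> E \<Longrightarrow> b \<in> E \<Longrightarrow> a * b \<in> E"
    using assms unfolding unital_subring_def by auto
  have "1 - 1 \<in> E" using * by blast
  then show 0: "0 \<in> E" by simp
  show "\<And>a b. a \<in> E \<Longrightarrow> b \<in> E \<Longrightarrow> a + b \<in> E" using diff_closed_add * 0 by metis
qed

lemma ideal_inD:
  assumes "ideal_in E R"
  shows "R \<subseteq> E" and "0 \<in> R" and "\<And>a b. a \<in> R \<Longrightarrow> b \<in> R \<Longrightarrow> a - b \<in> R"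
    and "\<And>a b. a \<in> R \<Longrightarrow> b \<in> R \<Longrightarrow> a + b \<in> R"
    and "\<And>e a. e \<in> E \<Longrightarrow> a \<in> R \<Longrightarrow> e * a \<in> R"
    and "\<And>e a. e \<in> E \<Longrightarrow> a \<in> R \<Longrightarrow> a * e \<in> R"
  using assms diff_closed_add[of R] unfolding ideal_in_def by auto

lemma unital_subring_generated_ring: "unital_subring (generated_ring X)"
  unfolding unital_subring_def by (auto intro: generated_ring.intros)

lemma generated_ring_mono:
  assumes "X \<subseteq> Y"
  shows "generated_ring X \<subseteq> generated_ring Y"
proof
  fix a assume "a \<in> generated_ring X"
  then show "a \<in> generated_ring Y"
    by induction (use assms in \<open>auto intro: generated_ring.intros\<close>)
qed

lemma set_power_Suc_elim:
  assumes "a \<in> R ^ Suc n"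
  obtains b c where "b \<in> R" and "c \<in> R ^ n" and "a = b * c"
  using assms by (auto elim: set_times_elim)

lemma set_power_subset_subring:
  assumes "unital_subring E" and "R \<subseteq> E"
  shows "R ^ n \<subseteq> E"
proof (induction n)
  case 0
  then show ?case using unital_subringD[OF assms(1)] by (auto simp: set_one)
next
  case (Suc n)
  then show ?case using unital_subringD(4)[OF assms(1)] assms(2)
    by (auto elim!: set_power_Suc_elim simp del: power_Suc)
qed

lemma set_power_mono:
  fixes A B :: "'a::monoid_mult set"
  assumes "A \<subseteq> B"
  shows "A ^ n \<subseteq> B ^ n"
  by (induction n) (simp_all add: set_times_mono2 assms)

text \<open>In the expansion every term with a factor from \<open>B\<close> falls into
  \<open>B\<close>, which leaves one product of elements of \<open>A\<close>. As \<open>A\<close> is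
  just a subset of \<open>E\<close>, the image of an ideal under a derivation is covered.\<close>

lemma power_plus_ideal_subset:
  assumes E: "unital_subring E" and A: "A \<subseteq> E" and B: "ideal_in E B"
  shows "(A + B) ^ n \<subseteq> A ^ n + B"
proof (induction n)
  case 0
  have "1 + 0 \<in> {1} + B" using ideal_inD(2)[OF B] by (intro set_plus_intro) auto
  then show ?case by (simp add: set_one)
next
  case (Suc n)
  show ?case
  proof
    fix x assume "x \<in> (A + B) ^ Suc n"
    then obtain y z' where yz: "y \<in> A + B" "z' \<in> (A + B) ^ n" "x = y * z'"
      by (rule set_power_Suc_elim)
    obtain a b where y: "y = a + b" "a \<in> A" "b \<in> B"
      using yz(1) by (rule set_plus_elim)
    obtain c d where z: "z' = c + d" "c \<in> A ^ n" "d \<in> B"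
      using subsetD[OF Suc yz(2)] by (rule set_plus_elim)
    have x: "x = a * c + (a * d + b * (c + d))"
      unfolding yz(3) y(1) z(1) by (simp add: algebra_simps)
    have "c \<in> E" using set_power_subset_subring[OF E A] z by blast
    then have "c + d \<in> E" using z ideal_inD(1)[OF B] unital_subringD(5)[OF E] by blast
    then have "a * d + b * (c + d) \<in> B" using y z A by (intro ideal_inD[OF B]) auto
    moreover have "a * c \<in> A ^ Suc n" using y(2) z(2) by auto
    ultimately show "x \<in> A ^ Suc n + B" unfolding x by (intro set_plus_intro)
  qed
qed

lemma nat_elt_Suc: "nat_elt (Suc n) = nat_elt n + 1"
  by (simp add: nat_elt_def add.commute)

lemma nat_elt_commute: "nat_elt n * a = a * nat_elt n"
  by (simp add: nat_elt_def sum_distrib_left sum_distrib_right)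

lemma commutator_mult: "commutator x (a * b) = commutator x a * b + a * commutator x b"
  for x :: "'a::ring"
  by (simp add: algebra_simps)

lemma commutator_diff: "commutator x (a - b) = commutator x a - commutator x b"
  for x :: "'a::ring"
  by (simp add: algebra_simps)

text \<open>A commutator is a derivation, so it is enough to control it on the generators.\<close>

lemma commutator_closed_generated_ring:
  assumes "\<And>y. y \<in> X \<Longrightarrow> commutator x y \<in> generated_ring X"
    and "a \<in> generated_ring X"
  shows "commutator x a \<in> generated_ring X"
  using assms(2)
proof induction
  case generated_ring_one
  then show ?case using unital_subringD(2)[OF unital_subring_generated_ring] by simp
next
  case (generated_ring_base a)
  then show ?case using assms(1) by blast
next
  case (generated_ring_diff a b)
  then show ?case by (simp only: commutator_diff generated_ring.generated_ring_diff)
next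
  case (generated_ring_mult a b)
  then show ?case unfolding commutator_mult
    by (intro unital_subringD[OF unital_subring_generated_ring] generated_ring_mult)
qed

text \<open>The power is the elementwise one: \<open>R ^ n\<close> consists of the products of
  \<open>n\<close> elements of \<open>R\<close>, without sums. Sums can be left out because every
  \<open>Z\<close> of interest is additively closed.\<close>

definition nilpotent_mod :: "'a::{ring, monoid_mult} set \<Rightarrow> 'a set \<Rightarrow> bool"
  where "nilpotent_mod Z R \<longleftrightarrow> (\<exists>n. R ^ n \<subseteq> Z)"

text \<open>The union is an ideal because any two nilpotent ideals lie in a common third, their sum.
  No single exponent is claimed; for left multiplications it comes from
  \<open>nilpotency_bound\<close>.\<close>

definition nil_radical :: "'a::{ring, monoid_mult} set \<Rightarrow> 'a set \<Rightarrow> 'a set"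
  where "nil_radical Z E = \<Union>{R. ideal_in E R \<and> nilpotent_mod Z R}"

text \<open>Ideals are taken in varying subrings \<open>E\<close> of \<open>E0\<close>, while
  nilpotency is always measured against the one fixed ideal \<open>Z\<close> of
  \<open>E0\<close>.\<close>

locale subring_modulo =
  fixes E0 Z :: "'a::{ring, monoid_mult} set"
  assumes subring0: "unital_subring E0" and ideal0: "ideal_in E0 Z"
begin

text \<open>Raising the inclusion to the \<open>n\<close>-th power, where
  \<open>R ^ n \<subseteq> Z\<close>, puts \<open>M ^ (k * n)\<close> into \<open>R ^ n + Z\<close>,
  hence into \<open>Z\<close>.\<close>

lemma power_subset_imp_nilpotent_mod:
  assumes "R \<subseteq> E0" and "nilpotent_mod Z R" and "M ^ k \<subseteq> R + Z"
  shows "nilpotent_mod Z M"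
proof -
  obtain n where n: "R ^ n \<subseteq> Z" using assms(2) unfolding nilpotent_mod_def by blast
  have "M ^ (k * n) = (M ^ k) ^ n" by (rule power_mult)
  also have "\<dots> \<subseteq> (R + Z) ^ n" by (rule set_power_mono[OF assms(3)])
  also have "\<dots> \<subseteq> R ^ n + Z" by (rule power_plus_ideal_subset[OF subring0 assms(1) ideal0])
  also have "\<dots> \<subseteq> Z" using n ideal_inD(4)[OF ideal0] by (auto elim!: set_plus_elim)
  finally show ?thesis unfolding nilpotent_mod_def by blast
qed

text \<open>For large \<open>n\<close>,
  \<open>(A + B) ^ n \<subseteq> A ^ n + B \<subseteq> B + Z\<close>, and \<open>B\<close> is
  nilpotent itself.\<close>

lemma nilpotent_ideal_sum:
  assumes E: "unital_subring E" "E \<subseteq> E0"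
    and A: "ideal_in E A" "nilpotent_mod Z A" and B: "ideal_in E B" "nilpotent_mod Z B"
  shows "ideal_in E (A + B)" and "nilpotent_mod Z (A + B)" and "A \<subseteq> A + B" and "B \<subseteq> A + B"
proof -
  note a = ideal_inD[OF A(1)] and b = ideal_inD[OF B(1)] and e = unital_subringD[OF E(1)]
  have "0 + 0 \<in> A + B" using a(2) b(2) by (rule set_plus_intro)
  moreover have "x - y \<in> A + B" if "x \<in> A + B" "y \<in> A + B" for x y
  proof -
    obtain p q r s where *: "x = p + q" "p \<in> A" "q \<in> B" "y = r + s" "r \<in> A" "s \<in> B"
      using \<open>x \<in> A + B\<close> \<open>y \<in> A + B\<close> by (metis set_plus_elim)
    have "(p - r) + (q - s) \<in> A + B" using * a(3) b(3) by (intro set_plus_intro) auto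
    then show ?thesis using * by (simp add: algebra_simps)
  qed
  moreover have "x * y \<in> A + B" "y * x \<in> A + B" if "x \<in> E" "y \<in> A + B" for x y
  proof -
    obtain r s where *: "y = r + s" "r \<in> A" "s \<in> B" using \<open>y \<in> A + B\<close> by (metis set_plus_elim)
    then show "x * y \<in> A + B" "y * x \<in> A + B"
      using a(5,6) b(5,6) \<open>x \<in> E\<close> by (auto simp: algebra_simps)
  qed
  moreover have "A + B \<subseteq> E" using a(1) b(1) e(5) by (auto elim!: set_plus_elim)
  ultimately show "ideal_in E (A + B)" unfolding ideal_in_def by auto
  show "A \<subseteq> A + B" using b(2) by (metis add.right_neutral set_plus_intro subsetI)
  show "B \<subseteq> A + B" using a(2) by (metis add.left_neutral set_plus_intro subsetI)
  obtain n where n: "A ^ n \<subseteq> Z" using A(2) unfolding nilpotent_mod_def by blast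
  have "(A + B) ^ n \<subseteq> A ^ n + B" by (rule power_plus_ideal_subset[OF E(1) a(1) B(1)])
  also have "\<dots> \<subseteq> B + Z" using n by (metis add.commute order_refl set_plus_mono2)
  finally show "nilpotent_mod Z (A + B)"
    using power_subset_imp_nilpotent_mod[OF _ B(2)] b(1) E(2) by blast
qed

lemma ideal_nil_radical:
  assumes E: "unital_subring E" "E \<subseteq> E0"
  shows "ideal_in E (nil_radical Z E)"
proof -
  have "ideal_in E {0}" using unital_subringD[OF E(1)] by (auto simp: ideal_in_def)
  moreover have "nilpotent_mod Z {0}" unfolding nilpotent_mod_def
    using ideal_inD(2)[OF ideal0]
    by (intro exI[of _ 1]) (simp only: power_one_right empty_subsetI insert_subset)
  ultimately have "0 \<in> nil_radical Z E" unfolding nil_radical_def by blast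
  moreover have "a - b \<in> nil_radical Z E" if ab: "a \<in> nil_radical Z E" "b \<in> nil_radical Z E" for a b
  proof -
    obtain A B where A: "ideal_in E A" "nilpotent_mod Z A" "a \<in> A"
      and B: "ideal_in E B" "nilpotent_mod Z B" "b \<in> B"
      using ab unfolding nil_radical_def by blast
    note s = nilpotent_ideal_sum[OF E A(1,2) B(1,2)]
    then have "a - b \<in> A + B" using A B ideal_inD(3)[OF s(1)] by blast
    then show ?thesis using s unfolding nil_radical_def by blast
  qed
  moreover have "e * a \<in> nil_radical Z E \<and> a * e \<in> nil_radical Z E"
    if "e \<in> E" "a \<in> nil_radical Z E" for e a
    using that ideal_inD(5,6) unfolding nil_radical_def by blast
  moreover have "nil_radical Z E \<subseteq> E" unfolding nil_radical_def using ideal_inD(1) by blast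
  ultimately show ?thesis unfolding ideal_in_def by blast
qed

text \<open>A single product involves finitely many nilpotent ideals, and their sum is again one.
  Thus a uniform exponent for nilpotent ideals is inherited by their union.\<close>

lemma nil_radical_power_mem:
  assumes E: "unital_subring E" "E \<subseteq> E0" and "a \<in> nil_radical Z E ^ m"
  obtains R where "ideal_in E R" and "nilpotent_mod Z R" and "a \<in> R ^ m"
proof -
  have "\<exists>R. ideal_in E R \<and> nilpotent_mod Z R \<and> a \<in> R ^ m"
    using assms(3)
  proof (induction m arbitrary: a)
    case 0
    \<comment> \<open>The empty product needs some nilpotent ideal as witness; the one containing
      \<open>0\<close> serves.\<close>
    have "0 \<in> nil_radical Z E" using ideal_inD(2)[OF ideal_nil_radical[OF E]] .
    then show ?case using 0 unfolding nil_radical_def by auto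
  next
    case (Suc m)
    obtain b c where bc: "b \<in> nil_radical Z E" "c \<in> nil_radical Z E ^ m" "a = b * c"
      using Suc.prems by (rule set_power_Suc_elim)
    obtain A where A: "ideal_in E A" "nilpotent_mod Z A" "c \<in> A ^ m"
      using Suc.IH bc(2) by blast
    obtain B where B: "ideal_in E B" "nilpotent_mod Z B" "b \<in> B"
      using bc(1) unfolding nil_radical_def by blast
    note s = nilpotent_ideal_sum[OF E B(1,2) A(1,2)]
    have "a \<in> (B + A) ^ Suc m"
      using bc(3) A(3) B(3) s(3) set_power_mono[OF s(4), of m] by auto
    then show ?case using s by blast
  qed
  then show thesis using that by blast
qed

end

section \<open>Higher derivatives of products modulo an ideal\<close>

locale ring_derivation =
  fixes E R :: "'a::{ring, monoid_mult} set" and d :: "'a \<Rightarrow> 'a"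
  assumes subring: "unital_subring E" and ideal: "ideal_in E R"
    and closed: "\<And>a. a \<in> E \<Longrightarrow> d a \<in> E"
    and derivation: "\<And>a b. d (a * b) = d a * b + a * d b"
    and additive: "\<And>a b. d (a - b) = d a - d b"
begin

lemmas subringD = unital_subringD[OF subring]
lemmas idealD = ideal_inD[OF ideal]

lemma der_zero: "d 0 = 0"
  using additive[of 0 0] by simp

lemma der_add: "d (a + b) = d a + d b"
  using additive[of a "0 - b"] additive[of 0 b] der_zero by simp

lemma iter_add: "(d ^^ n) (a + b) = (d ^^ n) a + (d ^^ n) b"
  by (induction n) (simp_all add: der_add)

lemma iter_closed: "a \<in> E \<Longrightarrow> (d ^^ n) a \<in> E"
  by (induction n) (simp_all add: closed)

lemma iter_mult_Suc: "(d ^^ Suc n) (a * b) = (d ^^ n) (d a * b) + (d ^^ n) (a * d b)"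
  by (simp add: funpow_Suc_right derivation iter_add del: funpow.simps)

lemma iter_der: "(d ^^ n) (d b) = (d ^^ Suc n) b"
  by (simp only: funpow_Suc_right comp_apply)

text \<open>By the product rule each term of the \<open>n\<close>-th derivative contains a
  derivative of \<open>b\<close> of order at most \<open>n\<close>, hence a factor in
  \<open>R\<close>.\<close>

lemma iter_mult_mem:
  assumes "e \<in> E" and "b \<in> E" and "\<And>i. i < m \<Longrightarrow> (d ^^ i) b \<in> R" and "n < m"
  shows "(d ^^ n) (e * b) \<in> R"
  using assms
proof (induction n arbitrary: e b m)
  case 0
  then show ?case using idealD(5)[of e b] by (metis funpow_0)
next
  case (Suc n)
  have "(d ^^ n) (d e * b) \<in> R"
    using Suc.prems closed by (intro Suc.IH[of _ _ m]) auto
  moreover have "(d ^^ n) (e * d b) \<in> R"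
  proof (rule Suc.IH[of _ _ "m - 1"])
    show "(d ^^ i) (d b) \<in> R" if "i < m - 1" for i
      using Suc.prems(3)[of "Suc i"] that by (simp only: iter_der)
  qed (use Suc.prems closed in auto)
  ultimately show ?case unfolding iter_mult_Suc using idealD(4) by blast
qed

text \<open>One order beyond \<open>iter_mult_mem\<close>, the only term that may escape
  \<open>R\<close> is the one in which all derivatives fall on \<open>b\<close>.\<close>

lemma iter_mult_cong:
  assumes "e \<in> E" and "b \<in> E" and "\<And>i. i < m \<Longrightarrow> (d ^^ i) b \<in> R"
  shows "(d ^^ m) (e * b) - e * (d ^^ m) b \<in> R"
  using assms
proof (induction m arbitrary: e b)
  case 0
  then show ?case using idealD(2) by simp
next
  case (Suc m)
  have "(d ^^ m) (d e * b) \<in> R"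
    by (rule iter_mult_mem[of _ _ "Suc m"]) (use Suc.prems closed in auto)
  moreover have "(d ^^ m) (e * d b) - e * (d ^^ m) (d b) \<in> R"
    by (rule Suc.IH) (use Suc.prems(1,2) Suc.prems(3)[of "Suc _"] closed in \<open>auto simp: funpow_swap1\<close>)
  ultimately have "(d ^^ m) (d e * b) + ((d ^^ m) (e * d b) - e * (d ^^ m) (d b)) \<in> R"
    by (rule idealD(4))
  then show ?case by (simp only: iter_mult_Suc iter_der add_diff_eq)
qed

text \<open>For \<open>n = m\<close> the one remaining term \<open>a * (d ^^ m) b\<close> has its
  factor \<open>a\<close> in \<open>R\<close>.\<close>

lemma iter_ideal_mult_mem:
  assumes "a \<in> R" and "b \<in> E" and "\<And>i. i < m \<Longrightarrow> (d ^^ i) b \<in> R" and "n \<le> m"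
  shows "(d ^^ n) (a * b) \<in> R"
proof (cases "n = m")
  case True
  have "a * (d ^^ m) b \<in> R" using assms iter_closed idealD(6) by blast
  moreover have "(d ^^ m) (a * b) - a * (d ^^ m) b \<in> R"
    using iter_mult_cong assms idealD(1) by blast
  ultimately have "((d ^^ m) (a * b) - a * (d ^^ m) b) + a * (d ^^ m) b \<in> R"
    using idealD(4) by blast
  then show ?thesis using True by simp
next
  case False
  then show ?thesis using iter_mult_mem[of a b m n] assms idealD(1) by auto
qed

text \<open>Terms with fewer than \<open>m\<close> derivatives on \<open>b\<close> lie in
  \<open>R\<close>, and so does the term with all of them on \<open>b\<close>, because of its factor
  \<open>a\<close>. What remains has one derivative on \<open>a\<close> and binomial coefficient
  \<open>Suc m\<close>.\<close>

lemma iter_ideal_mult_cong: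
  assumes "a \<in> R" and "b \<in> E" and "\<And>i. i < m \<Longrightarrow> (d ^^ i) b \<in> R"
  shows "(d ^^ Suc m) (a * b) - nat_elt (Suc m) * (d a * (d ^^ m) b) \<in> R"
  using assms
proof (induction m arbitrary: b)
  case 0
  have "a * d b \<in> R" using 0 closed idealD(6) by blast
  then show ?case by (simp add: nat_elt_def derivation)
next
  case (Suc m)
  have a: "a \<in> E" using Suc.prems(1) idealD(1) by blast
  have "(d ^^ Suc m) (a * d b) - nat_elt (Suc m) * (d a * (d ^^ m) (d b)) \<in> R"
    by (rule Suc.IH) (use Suc.prems(1,2) Suc.prems(3)[of "Suc _"] closed in \<open>auto simp: funpow_swap1\<close>)
  moreover have "(d ^^ Suc m) (d a * b) - d a * (d ^^ Suc m) b \<in> R"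
    by (rule iter_mult_cong) (use Suc.prems closed a in auto)
  ultimately have "((d ^^ Suc m) (a * d b) - nat_elt (Suc m) * (d a * (d ^^ m) (d b)))
      + ((d ^^ Suc m) (d a * b) - d a * (d ^^ Suc m) b) \<in> R"
    by (rule idealD(4))
  moreover have "(d ^^ Suc (Suc m)) (a * b) - nat_elt (Suc (Suc m)) * (d a * (d ^^ Suc m) b) =
      ((d ^^ Suc m) (a * d b) - nat_elt (Suc m) * (d a * (d ^^ m) (d b)))
      + ((d ^^ Suc m) (d a * b) - d a * (d ^^ Suc m) b)"
    unfolding iter_mult_Suc[of "Suc m"] iter_der nat_elt_Suc[of "Suc m"]
    by (simp only: distrib_right mult_1_left) (simp only: algebra_simps)
  ultimately show ?case by simp
qed

text \<open>For \<open>q = d a1 * ... * d am\<close> take \<open>p = a1 * ... * am\<close>: its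
  \<open>m\<close>-th derivative is \<open>m!\<close> times \<open>q\<close> modulo
  \<open>R\<close>, and \<open>u\<close> inverts \<open>m!\<close>.\<close>

lemma power_der_image:
  assumes nat_inverse: "\<And>n. 0 < n \<Longrightarrow> \<exists>u\<in>E. u * nat_elt n = 1"
    and q: "q \<in> (d ` R) ^ m"
  obtains p u where "p \<in> R ^ m" and "u \<in> E" and "q - u * (d ^^ m) p \<in> R"
proof -
  \<comment> \<open>The induction also needs the lower derivatives of \<open>p\<close> in
    \<open>R\<close>, so that \<open>iter_ideal_mult_cong\<close> applies, and \<open>u\<close>
    central, so that it can be moved past \<open>d a\<close>.\<close>
  have "\<exists>p u. p \<in> R ^ m \<and> (\<forall>i<m. (d ^^ i) p \<in> R) \<and> u \<in> E \<and> (\<forall>x. u * x = x * u)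
      \<and> q - u * (d ^^ m) p \<in> R"
    using q
  proof (induction m arbitrary: q)
    case 0
    then show ?case using subringD(1) idealD(2)
      by (intro exI[of _ 1] conjI) (auto simp: set_one)
  next
    case (Suc m)
    obtain b q' where "b \<in> d ` R" and q': "q' \<in> (d ` R) ^ m" "q = b * q'"
      using Suc.prems by (rule set_power_Suc_elim)
    then obtain a where a: "a \<in> R" "b = d a" by blast
    obtain p u where p: "p \<in> R ^ m" "\<forall>i<m. (d ^^ i) p \<in> R" and u: "u \<in> E" "\<forall>x. u * x = x * u"
      and pq: "q' - u * (d ^^ m) p \<in> R"
      using Suc.IH[OF q'(1)] by blast
    obtain v where v: "v \<in> E" "v * nat_elt (Suc m) = 1" using nat_inverse by blast
    \<comment> \<open>The inverse of a central element is central.\<close>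
    have v_central: "v * x = x * v" for x
    proof -
      have "v * x = v * x * (nat_elt (Suc m) * v)"
        using v(2) nat_elt_commute[of "Suc m" v] by simp
      also have "\<dots> = v * nat_elt (Suc m) * (x * v)"
        using nat_elt_commute[of "Suc m" x] by (metis mult.assoc)
      finally show ?thesis using v(2) by simp
    qed
    have aE: "a \<in> E" and pE: "p \<in> E"
      using a idealD(1) p set_power_subset_subring[OF subring idealD(1)] by auto
    let ?P = "(d ^^ m) p"
    have "u * v * ((d ^^ Suc m) (a * p) - nat_elt (Suc m) * (d a * ?P)) \<in> R"
      by (intro idealD(5) subringD(4) u v iter_ideal_mult_cong) (use a p pE in auto)
    moreover have "v * (nat_elt (Suc m) * (d a * ?P)) = d a * ?P"
      by (metis v(2) mult.assoc mult_1_left)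
    ultimately have 1: "u * v * (d ^^ Suc m) (a * p) - u * (d a * ?P) \<in> R"
      by (simp only: right_diff_distrib mult.assoc)
    have "d a * (q' - u * ?P) \<in> R" using pq closed[OF aE] by (intro idealD(5))
    then have "d a * q' - u * (d a * ?P) \<in> R"
      using u(2) by (metis mult.assoc right_diff_distrib)
    from idealD(3)[OF this 1] have "q - u * v * (d ^^ Suc m) (a * p) \<in> R"
      by (simp add: q'(2) a(2))
    moreover have "a * p \<in> R ^ Suc m" using a p by auto
    moreover have "\<forall>i<Suc m. (d ^^ i) (a * p) \<in> R"
      using iter_ideal_mult_mem[of a p m] a p pE by auto
    moreover have "u * v \<in> E" using u v subringD(4) by blast
    moreover have "\<forall>x. u * v * x = x * (u * v)"
      using u(2) v_central by (metis mult.assoc)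
    ultimately show ?case by blast
  qed
  then show thesis using that by blast
qed

end

section \<open>Membership in the nilpotent radical by means of commutators\<close>

context subring_modulo
begin

text \<open>
  Applying \<open>d\<close> to a vanishing product of \<open>k\<close> elements of a nilpotent ideal \<open>R\<close> exactly \<open>k\<close> times
  leaves \<open>k!\<close> times the product of the derivatives modulo \<open>R\<close>, so \<open>R + d R\<close> is again nilpotent.
\<close>

lemma commutator_nil_radical:
  assumes E: "unital_subring E" "E \<subseteq> E0" and x: "x \<in> E0"
    and closed: "\<And>a. a \<in> E \<Longrightarrow> commutator x a \<in> E"
    and nat_inverse: "\<And>n. 0 < n \<Longrightarrow> \<exists>u\<in>E. u * nat_elt n = 1"
    and r: "r \<in> nil_radical Z E"
  shows "commutator x r \<in> nil_radical Z E"
proof -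
  obtain R where R: "ideal_in E R" "nilpotent_mod Z R" "r \<in> R"
    using r unfolding nil_radical_def by blast
  define d where "d = commutator x"
  have dm: "d (a * b) = d a * b + a * d b" and dd: "d (a - b) = d a - d b" for a b
    by (simp_all add: d_def algebra_simps)
  interpret ring_derivation E R d
    by unfold_locales (use E R closed dm dd in \<open>auto simp: d_def\<close>)
  \<comment> \<open>The image of \<open>R\<close> alone is not visibly an ideal:
    \<open>e * d a = d (e * a) - d e * a\<close>, and the summand \<open>R\<close> absorbs the last
    term.\<close>
  define M where "M = d ` R + R"
  have MI: "d a + b \<in> M" if "a \<in> R" "b \<in> R" for a b
    using that unfolding M_def by (intro set_plus_intro imageI)
  have ME: "\<exists>a\<in>R. \<exists>b\<in>R. y = d a + b" if "y \<in> M" for y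
    using that unfolding M_def by (auto elim!: set_plus_elim)
  have "0 \<in> M" using MI[OF idealD(2) idealD(2)] der_zero by simp
  moreover have "M \<subseteq> E" unfolding M_def
    using idealD(1) closed subringD(5) by (auto elim!: set_plus_elim simp: d_def subset_iff)
  moreover have "y - z \<in> M" if yz: "y \<in> M" "z \<in> M" for y z
  proof -
    obtain a b a' b' where *: "y = d a + b" "z = d a' + b'" "a \<in> R" "b \<in> R" "a' \<in> R" "b' \<in> R"
      using ME[OF yz(1)] ME[OF yz(2)] by blast
    have "y - z = d (a - a') + (b - b')" using * by (simp add: dd)
    then show ?thesis using * by (simp only: MI idealD(3))
  qed
  moreover have "e * y \<in> M \<and> y * e \<in> M" if ey: "e \<in> E" "y \<in> M" for e y
  proof -
    obtain a b where *: "y = d a + b" "a \<in> R" "b \<in> R"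
      using ME[OF ey(2)] by blast
    have "e * y = d (e * a) + (e * b - d e * a)" "y * e = d (a * e) + (b * e - a * d e)"
      using * by (simp_all add: dm algebra_simps)
    moreover have "d e \<in> E" using closed ey by (simp add: d_def)
    ultimately show ?thesis using * ey idealD(3,5,6) by (simp add: MI)
  qed
  ultimately have M: "ideal_in E M" unfolding ideal_in_def by blast
  obtain k where k: "R ^ k \<subseteq> Z" using R(2) unfolding nilpotent_mod_def by blast
  \<comment> \<open>An ideal of \<open>E0\<close> is stable under the commutator with
    \<open>x \<in> E0\<close>, so vanishing modulo \<open>Z\<close> survives
    differentiation.\<close>
  have dZ: "(d ^^ n) p \<in> Z" if "p \<in> Z" for p n
    using that ideal_inD(3,5,6)[OF ideal0] x by (induction n) (auto simp: d_def)
  have q: "q \<in> R + Z" if "q \<in> (d ` R) ^ k" for q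
  proof -
    obtain p u where *: "p \<in> R ^ k" "u \<in> E" "q - u * (d ^^ k) p \<in> R"
      using power_der_image[OF nat_inverse \<open>q \<in> (d ` R) ^ k\<close>] by blast
    have "u * (d ^^ k) p \<in> Z"
      using * k E(2) dZ by (intro ideal_inD(5)[OF ideal0]) auto
    with *(3) have "(q - u * (d ^^ k) p) + u * (d ^^ k) p \<in> R + Z" by (rule set_plus_intro)
    then show ?thesis by simp
  qed
  have "d ` R \<subseteq> E" using idealD(1) closed by (auto simp: d_def)
  then have "M ^ k \<subseteq> (d ` R) ^ k + R"
    unfolding M_def by (rule power_plus_ideal_subset[OF E(1) _ R(1)])
  also have "\<dots> \<subseteq> R + Z"
  proof
    fix y assume "y \<in> (d ` R) ^ k + R"
    then obtain q b where *: "y = q + b" "q \<in> (d ` R) ^ k" "b \<in> R" by (rule set_plus_elim)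
    then obtain a z where az: "q = a + z" "a \<in> R" "z \<in> Z"
      using q[OF *(2)] by (metis set_plus_elim)
    have "(a + b) + z \<in> R + Z" using * az idealD(4) by (intro set_plus_intro) auto
    then show "y \<in> R + Z" using * az by (simp add: algebra_simps)
  qed
  finally have "nilpotent_mod Z M"
    using power_subset_imp_nilpotent_mod R(2) idealD(1) E(2) by blast
  moreover have "d r \<in> M" using MI[OF R(3) idealD(2)] by simp
  ultimately show ?thesis using M unfolding nil_radical_def d_def by blast
qed

text \<open>For a subring \<open>E\<close> this is the additive group spanned by the products
  \<open>r1 * ... * rn * e\<close> with all \<open>ri\<close> in \<open>R\<close> and
  \<open>e\<close> in \<open>E\<close>.\<close>

primrec ideal_power :: "'a set \<Rightarrow> 'a set \<Rightarrow> nat \<Rightarrow> 'a set"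
  where
    "ideal_power E R 0 = E"
  | "ideal_power E R (Suc n) = additive_closure (R * ideal_power E R n)"

text \<open>As \<open>x * r = r * x + commutator x r\<close>, elements of \<open>R\<close> can be
  moved to the left past the whole generated ring \<open>E\<close>. Hence
  \<open>ideal_power E R 1\<close> is a two-sided ideal whose \<open>n\<close>-th power lies in
  \<open>ideal_power E R n\<close>, and the latter is in \<open>Z\<close> as soon as
  \<open>R ^ n\<close> is.\<close>

lemma subset_nil_radical:
  assumes X: "generated_ring X \<subseteq> E0" and RE: "R \<subseteq> generated_ring X" and nil: "nilpotent_mod Z R"
    and comm: "\<And>x r. x \<in> X \<Longrightarrow> r \<in> R \<Longrightarrow> commutator x r \<in> R"
  shows "R \<subseteq> nil_radical Z (generated_ring X)"
proof -
  define E where "E = generated_ring X"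
  define S where "S = ideal_power E R"
  have subring: "unital_subring E" unfolding E_def by (rule unital_subring_generated_ring)
  note subringD = unital_subringD[OF subring]
  note Z = ideal_inD[OF ideal0]
  have S0: "S 0 = E" and SS: "S (Suc n) = additive_closure (R * S n)" for n
    by (simp_all add: S_def)
  have diff: "a - b \<in> S n" if "a \<in> S n" "b \<in> S n" for a b n
    using that subringD(3) by (cases n) (auto simp: S0 SS intro: additive_closure_diff)
  have zero: "0 \<in> S n" for n
    using subringD(2) by (cases n) (auto simp: S0 SS intro: additive_closure_zero)
  have add: "a + b \<in> S n" if "a \<in> S n" "b \<in> S n" for a b n
    using that diff zero diff_closed_add by metis
  have RS: "r * s \<in> S (Suc n)" if "r \<in> R" "s \<in> S n" for r s n
    using that by (auto simp: SS intro: additive_closure_base)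
  have induct: "P y" if "y \<in> S (Suc n)" and "P 0"
    and "\<And>r s. r \<in> R \<Longrightarrow> s \<in> S n \<Longrightarrow> P (r * s)"
    and "\<And>a b. P a \<Longrightarrow> P b \<Longrightarrow> P (a - b)" for P y n
    using \<open>y \<in> S (Suc n)\<close> unfolding SS
    by induction (use that(2-) in \<open>auto elim!: set_times_elim\<close>)
  have left: "e * y \<in> S n" if "e \<in> E" "y \<in> S n" for e y n
    using that
  proof (induction n arbitrary: e y)
    case 0
    then show ?case using subringD(4) S0 by auto
  next
    case (Suc n)
    have gen: "x * y \<in> S (Suc n)" if "x \<in> X" "y \<in> S (Suc n)" for x y
    proof (rule induct[OF \<open>y \<in> S (Suc n)\<close>])
      fix r s assume rs: "r \<in> R" "s \<in> S n"
      have "x * s \<in> S n"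
        using Suc.IH rs(2) generated_ring_base[OF that(1)] unfolding E_def by blast
      then have "r * (x * s) + commutator x r * s \<in> S (Suc n)"
        using rs that(1) comm by (intro add RS) auto
      then show "x * (r * s) \<in> S (Suc n)" by (simp add: algebra_simps)
    qed (use zero diff in \<open>simp_all add: right_diff_distrib\<close>)
    from Suc.prems(1) have "e \<in> generated_ring X" unfolding E_def .
    then show ?case using Suc.prems(2)
      by (induction arbitrary: y)
        (simp_all add: gen mult.assoc left_diff_distrib diff)
  qed
  have right: "y * e \<in> S n" if "e \<in> E" "y \<in> S n" for e y n
    using that(2)
  proof (induction n arbitrary: y)
    case 0
    then show ?case using subringD(4) S0 that(1) by auto
  next
    case (Suc n)
    show ?case
      by (rule induct[OF Suc.prems])
        (use zero diff RS Suc.IH in \<open>simp_all add: left_diff_distrib mult.assoc\<close>)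
  qed
  have mult: "y * z \<in> S (Suc n)" if "y \<in> S (Suc 0)" "z \<in> S n" for y z n
    by (rule induct[OF that(1)])
      (use zero diff RS left that(2) S0 in \<open>simp_all add: left_diff_distrib mult.assoc\<close>)
  have power: "S (Suc 0) ^ n \<subseteq> S n" for n
  proof (induction n)
    case 0
    then show ?case using subringD(1) by (simp add: S0 set_one)
  next
    case (Suc n)
    then show ?case using mult by (auto elim!: set_power_Suc_elim simp del: power_Suc)
  qed
  obtain N where N: "R ^ N \<subseteq> Z" using nil unfolding nilpotent_mod_def by blast
  \<comment> \<open>The factors from \<open>R\<close> pass one by one from \<open>y\<close> to
    \<open>g\<close> while \<open>m + n\<close> stays constant; in the end
    \<open>R ^ N \<subseteq> Z\<close> applies to \<open>g\<close>, and \<open>Z\<close> absorbs the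
    rest.\<close>
  have S_Z: "g * y \<in> Z" if "g \<in> R ^ m" "y \<in> S n" "m + n = N" for g y m n
    using that
  proof (induction n arbitrary: g y m)
    case 0
    then show ?case using N Z(6) X unfolding S0 E_def by auto
  next
    case (Suc n)
    show ?case
    proof (rule induct[OF Suc.prems(2)])
      fix r s assume "r \<in> R" "s \<in> S n"
      moreover from this have "g * r \<in> R ^ Suc m"
        using Suc.prems(1) by (metis power_Suc2 set_times_intro)
      ultimately show "g * (r * s) \<in> Z"
        using Suc.IH[of "g * r" "Suc m" s] Suc.prems(3) by (simp add: mult.assoc)
    qed (use Z(2,3) in \<open>simp_all add: right_diff_distrib\<close>)
  qed
  have "S N \<subseteq> Z" using S_Z[of 1 0 _ N] by (auto simp: set_one)
  then have "nilpotent_mod Z (S (Suc 0))"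
    using power[of N] unfolding nilpotent_mod_def by blast
  moreover have "ideal_in E (S (Suc 0))"
  proof -
    have "S (Suc 0) \<subseteq> E"
    proof
      fix y assume "y \<in> S (Suc 0)"
      then show "y \<in> E"
        by (rule induct) (use RE subringD S0 in \<open>auto simp: E_def\<close>)
    qed
    then show ?thesis using zero diff left right unfolding ideal_in_def by blast
  qed
  moreover have "R \<subseteq> S (Suc 0)" using RS[of _ 1 0] subringD(1) S0 by auto
  ultimately show ?thesis unfolding nil_radical_def E_def by blast
qed

end

section \<open>Left multiplications as additive endomorphisms\<close>

text \<open>The maps are only additive, since the type cannot refer to \<open>scale\<close>; those
  generated by scalars and left multiplications are linear by
  \<open>mult_ring_scale\<close>.\<close>

typedef (overloaded) 'v endo = "{f :: 'v::ab_group_add \<Rightarrow> 'v. \<forall>x y. f (x + y) = f x + f y}"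
  morphisms apply_endo Endo
  by (rule exI[of _ "\<lambda>x. x"]) simp

setup_lifting type_definition_endo

instantiation endo :: (ab_group_add) "{ring, monoid_mult}"
begin

lift_definition zero_endo :: "'a endo" is "\<lambda>_. 0" by simp
lift_definition one_endo :: "'a endo" is "\<lambda>x. x" by simp
lift_definition plus_endo :: "'a endo \<Rightarrow> 'a endo \<Rightarrow> 'a endo" is "\<lambda>f g x. f x + g x"
  by (simp add: algebra_simps)
lift_definition minus_endo :: "'a endo \<Rightarrow> 'a endo \<Rightarrow> 'a endo" is "\<lambda>f g x. f x - g x"
  by (simp add: algebra_simps)
lift_definition uminus_endo :: "'a endo \<Rightarrow> 'a endo" is "\<lambda>f x. - f x"
  by simp
lift_definition times_endo :: "'a endo \<Rightarrow> 'a endo \<Rightarrow> 'a endo" is "\<lambda>f g x. f (g x)"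
  by simp

instance
  by standard (transfer; simp add: fun_eq_iff algebra_simps)+

end

lemmas apply_endo_simps =
  zero_endo.rep_eq one_endo.rep_eq plus_endo.rep_eq minus_endo.rep_eq times_endo.rep_eq

lemma endo_eqI: "(\<And>x. apply_endo f x = apply_endo g x) \<Longrightarrow> f = g"
  by (simp add: apply_endo_inject[symmetric] fun_eq_iff)

locale leibniz_algebra_char_0 = leibniz_algebra scale mul
  for scale :: "'f::field_char_0 \<Rightarrow> 'v::ab_group_add \<Rightarrow> 'v" (infixr "*s" 75)
    and mul :: "'v \<Rightarrow> 'v \<Rightarrow> 'v" (infixl "\<cdot>" 70)

section \<open>Action series and residuals of subinvariant subalgebras\<close>

context leibniz_algebra
begin

lemma mul_left_simps:
  "(x + y) \<cdot> z = x \<cdot> z + y \<cdot> z" "(x - y) \<cdot> z = x \<cdot> z - y \<cdot> z" "(c *s x) \<cdot> z = c *s (x \<cdot> z)"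
  "0 \<cdot> z = 0"
proof -
  interpret l: Vector_Spaces.linear scale scale "\<lambda>x. x \<cdot> z" by (rule linear_left)
  show "(x + y) \<cdot> z = x \<cdot> z + y \<cdot> z" "(x - y) \<cdot> z = x \<cdot> z - y \<cdot> z" "(c *s x) \<cdot> z = c *s (x \<cdot> z)"
    "0 \<cdot> z = 0"
    by (rule l.add l.diff l.scale l.zero)+
qed

lemma mul_right_simps:
  "z \<cdot> (x + y) = z \<cdot> x + z \<cdot> y" "z \<cdot> (x - y) = z \<cdot> x - z \<cdot> y" "z \<cdot> (c *s x) = c *s (z \<cdot> x)"
  "z \<cdot> 0 = 0"
proof -
  interpret l: Vector_Spaces.linear scale scale "\<lambda>x. z \<cdot> x" by (rule linear_right)
  show "z \<cdot> (x + y) = z \<cdot> x + z \<cdot> y" "z \<cdot> (x - y) = z \<cdot> x - z \<cdot> y" "z \<cdot> (c *s x) = c *s (z \<cdot> x)"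
    "z \<cdot> 0 = 0"
    by (rule l.add l.diff l.scale l.zero)+
qed

lemma leibniz_left: "(x \<cdot> y) \<cdot> z = x \<cdot> (y \<cdot> z) - y \<cdot> (x \<cdot> z)"
  by (simp add: leibniz[of x y z])

lemma subspace_left_multipliers: "subspace T \<Longrightarrow> subspace {x. \<forall>y\<in>S. x \<cdot> y \<in> T}"
  by (auto simp: subspace_def mul_left_simps)

lemma subspace_right_multipliers: "subspace T \<Longrightarrow> subspace {y. \<forall>x\<in>S. x \<cdot> y \<in> T}"
  by (auto simp: subspace_def mul_right_simps)

text \<open>Each proper inclusion lowers the dimension. The dimension of the whole space bounds all
  chains alike; only one repetition is promised, since a chain may drop again afterwards.\<close>

lemma stabilization_bound:
  obtains N where "\<And>W :: nat \<Rightarrow> 'v set. (\<And>i. subspace (W i)) \<Longrightarrow> (\<And>i. W (Suc i) \<subseteq> W i) \<Longrightarrow>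
    \<exists>n\<le>N. W (Suc n) = W n"
proof -
  obtain Basis where "finite_dimensional_vector_space scale Basis" using finite_dimensional by blast
  then interpret fd: finite_dimensional_vector_space scale Basis .
  show thesis
  proof (rule that[of "dim (UNIV :: 'v set)"], rule ccontr)
    fix W :: "nat \<Rightarrow> 'v set"
    assume W: "\<And>i. subspace (W i)" "\<And>i. W (Suc i) \<subseteq> W i"
      and n: "\<not> (\<exists>n\<le>dim (UNIV :: 'v set). W (Suc n) = W n)"
    have "dim (W i) + i \<le> dim (UNIV :: 'v set)" if "i \<le> Suc (dim (UNIV :: 'v set))" for i
      using that
    proof (induction i)
      case 0
      then show ?case using fd.dim_subset[of "W 0" UNIV] by simp
    next
      case (Suc i)
      then have "W (Suc i) \<noteq> W i" using n by auto
      then have "dim (W (Suc i)) < dim (W i)"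
        using fd.subspace_dim_equal[of "W (Suc i)" "W i"] W by (meson not_less)
      then show ?case using Suc by simp
    qed
    from this[of "Suc (dim UNIV)"] show False by simp
  qed
qed

primrec action_series :: "'v set \<Rightarrow> nat \<Rightarrow> 'v set"
  where
    "action_series B 0 = UNIV"
  | "action_series B (Suc n) = span {b \<cdot> v | b v. b \<in> B \<and> v \<in> action_series B n}"

lemma subspace_action_series: "subspace (action_series B n)"
  by (cases n) auto

lemma action_series_decreasing: "action_series B (Suc n) \<subseteq> action_series B n"
proof (induction n)
  case (Suc n)
  then show ?case by (auto intro!: span_mono)
qed simp

lemma mul_action_series: "b \<in> B \<Longrightarrow> v \<in> action_series B n \<Longrightarrow> b \<cdot> v \<in> action_series B (Suc n)"
  by (auto intro: span_base)

lemma action_series_antimono: "m \<le> n \<Longrightarrow> action_series B n \<subseteq> action_series B m"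
  by (rule lift_Suc_antimono_le[of "action_series B"]) (rule action_series_decreasing)

text \<open>Each term is determined by its predecessor, so one repetition freezes the
  series.\<close>

lemma action_series_stabilizes:
  obtains N where "\<And>n. action_series B N \<subseteq> action_series B n"
    and "action_series B N = action_series B (Suc N)"
proof -
  obtain M where M: "\<And>W :: nat \<Rightarrow> 'v set. (\<And>i. subspace (W i)) \<Longrightarrow> (\<And>i. W (Suc i) \<subseteq> W i) \<Longrightarrow>
    \<exists>n\<le>M. W (Suc n) = W n" using stabilization_bound by blast
  obtain N where N: "action_series B (Suc N) = action_series B N"
    using M[of "action_series B"] subspace_action_series action_series_decreasing by blast
  have "action_series B (N + k) = action_series B N" for k
  proof (induction k)
    case (Suc k)
    have "action_series B (N + Suc k) = action_series B (Suc N)" using Suc by simp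
    then show ?case using N by simp
  qed simp
  then have "action_series B N \<subseteq> action_series B n" for n
    by (metis action_series_antimono le_add2)
  then show thesis using that N by blast
qed

definition subnormal_chain :: "nat \<Rightarrow> (nat \<Rightarrow> 'v set) \<Rightarrow> bool"
  where "subnormal_chain t c \<longleftrightarrow> c 0 = UNIV \<and>
    (\<forall>i\<le>t. subalgebra (c i)) \<and> (\<forall>i\<in>{1..t}. ideal_of (c i) (c (i - 1)))"

lemma subinvariant_iff_chain: "subinvariant B \<longleftrightarrow> (\<exists>t c. c t = B \<and> subnormal_chain t c)"
  by (auto simp: subinvariant_def subnormal_chain_def)

lemma subnormal_chainD:
  assumes "subnormal_chain t c"
  shows "c 0 = UNIV" and "i \<le> t \<Longrightarrow> subalgebra (c i)"
    and "i < t \<Longrightarrow> ideal_of (c (Suc i)) (c i)"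
  using assms by (auto simp: subnormal_chain_def dest!: bspec[of _ _ "Suc i"])

lemma subnormal_chain_le:
  assumes "subnormal_chain t c" and "i \<le> t"
  shows "c t \<subseteq> c i"
  using assms(2)
proof (induction rule: inc_induct)
  case (step i)
  then show ?case using subnormal_chainD(3)[OF assms(1), of i] by (auto simp: ideal_of_def)
qed simp

text \<open>
  The stable term of the action series is the nilpotent residual of \<open>B\<close>: being reproduced by left
  multiplication with \<open>B\<close>, it can be moved arbitrarily far down the series.
\<close>

lemma action_series_residual:
  assumes "subinvariant B"
  obtains n where "ideal_of (action_series B n) UNIV" and "action_series B n \<subseteq> B"
proof -
  obtain t c where c: "c t = B" "subnormal_chain t c"
    using assms subinvariant_iff_chain by blast
  obtain N where N: "\<And>n. action_series B N \<subseteq> action_series B n"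
    "action_series B N = action_series B (Suc N)" using action_series_stabilizes by blast
  define W where "W = action_series B N"
  have W: "subspace W" "W = span {b \<cdot> w | b w. b \<in> B \<and> w \<in> W}"
    using N(2) subspace_action_series by (auto simp: W_def)
  \<comment> \<open>\<open>W\<close> is spanned by the products \<open>b \<cdot> w\<close>, so any
    subspace containing these contains \<open>W\<close>; this drives both inductions below.\<close>
  have W_sub: "W \<subseteq> T" if "subspace T" "\<And>b w. b \<in> B \<Longrightarrow> w \<in> W \<Longrightarrow> b \<cdot> w \<in> T" for T
  proof -
    have "{b \<cdot> w | b w. b \<in> B \<and> w \<in> W} \<subseteq> T" using that(2) by blast
    from span_minimal[OF this that(1)] show ?thesis unfolding W(2)[symmetric] .
  qed
  have W_le: "W \<subseteq> action_series B n" for n using N(1) by (simp add: W_def)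
  have B_le: "B \<subseteq> c i" if "i \<le> t" for i using subnormal_chain_le[OF c(2) that] c(1) by simp
  \<comment> \<open>Multiplication by \<open>B \<subseteq> c (Suc i)\<close> carries
    \<open>c i\<close> into its ideal \<open>c (Suc i)\<close>, so the series descends at least as
    fast as the chain.\<close>
  have "action_series B i \<subseteq> c i" if "i \<le> t" for i
    using that
  proof (induction i)
    case 0
    then show ?case using subnormal_chainD(1)[OF c(2)] by simp
  next
    case (Suc i)
    then have "ideal_of (c (Suc i)) (c i)" using subnormal_chainD(3)[OF c(2), of i] by simp
    moreover have "b \<cdot> v \<in> c (Suc i)" if "b \<in> B" "v \<in> action_series B i" for b v
    proof -
      have "b \<in> c (Suc i)" "v \<in> c i" using that B_le[of "Suc i"] Suc by auto
      then show ?thesis using calculation by (simp add: ideal_of_def)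
    qed
    then have "{b \<cdot> v | b v. b \<in> B \<and> v \<in> action_series B i} \<subseteq> c (Suc i)" by blast
    ultimately show ?case by (simp add: ideal_of_def span_minimal)
  qed
  then have WB: "W \<subseteq> B" using W_le[of t] c(1) by auto
  \<comment> \<open>In \<open>(b \<cdot> w) \<cdot> v = b \<cdot> (w \<cdot> v) - w \<cdot> (b
    \<cdot> v)\<close> both terms gain one step from \<open>b\<close>. The case
    \<open>j = 0\<close>, \<open>n = N\<close> gives \<open>w \<cdot> v \<in> W\<close> for all
    \<open>v\<close>.\<close>
  have left: "W \<subseteq> {w. \<forall>v\<in>action_series B j. w \<cdot> v \<in> action_series B (n + j)}" for n j
  proof (induction n arbitrary: j)
    case 0
    then show ?case
      using WB mul_action_series[of _ B _ j] action_series_decreasing[of B j] by auto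
  next
    case (Suc n)
    have step: "(b \<cdot> w) \<cdot> v \<in> action_series B (Suc n + j)"
      if "b \<in> B" "w \<in> W" "v \<in> action_series B j" for b w v
    proof -
      have "b \<cdot> (w \<cdot> v) \<in> action_series B (Suc (n + j))"
        using Suc[of j] that by (intro mul_action_series) auto
      moreover have "b \<cdot> v \<in> action_series B (Suc j)" using that by (intro mul_action_series)
      then have "w \<cdot> (b \<cdot> v) \<in> action_series B (n + Suc j)" using Suc[of "Suc j"] that by blast
      ultimately show ?thesis
        using subspace_diff[OF subspace_action_series, of _ B "Suc (n + j)"]
        by (simp only: leibniz_left add_Suc add_Suc_right)
    qed
    show ?case
      by (rule W_sub[OF subspace_left_multipliers[OF subspace_action_series]])
        (blast intro: step)
  qed
  \<comment> \<open>Induction from \<open>c t = B\<close> up to the whole algebra. In \<open>x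
    \<cdot> (b \<cdot> w) = (x \<cdot> b) \<cdot> w + b \<cdot> (x \<cdot> w)\<close> the element
    \<open>x \<cdot> b\<close> is already in \<open>c (Suc i)\<close>, and \<open>b\<close> pushes
    the second term one step down the series.\<close>
  have chain: "\<forall>x\<in>c i. \<forall>w\<in>W. x \<cdot> w \<in> W" if "i \<le> t" for i
    using that
  proof (induction rule: inc_induct)
    case base
    show ?case
      using mul_action_series[of _ B _ N] unfolding c(1) N(2)[symmetric] W_def by blast
  next
    case (step i)
    have ideal: "ideal_of (c (Suc i)) (c i)" using subnormal_chainD(3)[OF c(2)] step by simp
    have "W \<subseteq> {w. \<forall>x\<in>c i. x \<cdot> w \<in> action_series B n}" for n
    proof (induction n)
      case 0
      then show ?case by simp
    next
      case (Suc n)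
      have move: "x \<cdot> (b \<cdot> w) \<in> action_series B (Suc n)" if "b \<in> B" "w \<in> W" "x \<in> c i" for b w x
      proof -
        have "x \<cdot> b \<in> c (Suc i)" using ideal B_le[of "Suc i"] that step by (auto simp: ideal_of_def)
        then have "(x \<cdot> b) \<cdot> w \<in> action_series B (Suc n)" using step(3) that W_le by blast
        moreover have "b \<cdot> (x \<cdot> w) \<in> action_series B (Suc n)"
          using Suc that by (intro mul_action_series) auto
        ultimately show ?thesis
          unfolding leibniz[of x b w] by (rule subspace_add[OF subspace_action_series])
      qed
      show ?case
        by (rule W_sub[OF subspace_right_multipliers[OF subspace_action_series]])
          (blast intro: move)
    qed
    from this[of N] show ?case unfolding W_def by blast
  qed
  have "w \<cdot> v \<in> W" "v \<cdot> w \<in> W" if "w \<in> W" for w v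
    using left[of 0 N] chain[of 0] subnormal_chainD(1)[OF c(2)] that by (auto simp: W_def)
  then have "ideal_of W UNIV" using W(1) by (simp add: ideal_of_def)
  then show thesis using that WB unfolding W_def by blast
qed

section \<open>Rings generated by left multiplications\<close>

lift_definition left_mult :: "'v \<Rightarrow> 'v endo" is "\<lambda>x y. x \<cdot> y"
  by (simp add: mul_right_simps)

lift_definition scalar_mult :: "'f \<Rightarrow> 'v endo" is "\<lambda>c y. c *s y"
  by (simp add: scale_right_distrib)

lemma left_mult_mul: "left_mult (x \<cdot> y) = commutator (left_mult x) (left_mult y)"
  by (rule endo_eqI) (simp add: apply_endo_simps left_mult.rep_eq leibniz_left)

lemma left_mult_diff: "left_mult (x - y) = left_mult x - left_mult y"
  by (rule endo_eqI) (simp add: apply_endo_simps left_mult.rep_eq mul_left_simps)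

lemma left_mult_zero: "left_mult 0 = 0"
  by (rule endo_eqI) (simp add: apply_endo_simps left_mult.rep_eq mul_left_simps)

lemma left_mult_scale: "left_mult (c *s x) = scalar_mult c * left_mult x"
  by (rule endo_eqI)
    (simp add: apply_endo_simps left_mult.rep_eq scalar_mult.rep_eq mul_left_simps)

lemma scalar_mult_mult: "scalar_mult c * scalar_mult d = scalar_mult (c * d)"
  by (rule endo_eqI) (simp add: apply_endo_simps scalar_mult.rep_eq)

lemma scalar_mult_one: "scalar_mult 1 = 1"
  by (rule endo_eqI) (simp add: apply_endo_simps scalar_mult.rep_eq)

lemma scalar_mult_of_nat: "scalar_mult (of_nat n) = nat_elt n"
proof (induction n)
  case 0
  show ?case by (rule endo_eqI) (simp add: nat_elt_def apply_endo_simps scalar_mult.rep_eq)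
next
  case (Suc n)
  have "scalar_mult (of_nat (Suc n)) = scalar_mult (of_nat n) + 1"
    by (rule endo_eqI) (simp add: apply_endo_simps scalar_mult.rep_eq scale_left_distrib)
  then show ?case using Suc by (simp add: nat_elt_Suc)
qed

text \<open>The scalars make positive integers invertible in characteristic zero; being central,
  they contribute only zero commutators.\<close>

definition mult_gens :: "'v set \<Rightarrow> 'v endo set"
  where "mult_gens S = range scalar_mult \<union> left_mult ` S"

abbreviation mult_ring :: "'v set \<Rightarrow> 'v endo set"
  where "mult_ring S \<equiv> generated_ring (mult_gens S)"

lemma mult_ring_mono: "S \<subseteq> T \<Longrightarrow> mult_ring S \<subseteq> mult_ring T"
  by (rule generated_ring_mono) (auto simp: mult_gens_def)

lemma left_mult_mem_mult_ring: "x \<in> S \<Longrightarrow> left_mult x \<in> mult_ring S"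
  by (rule generated_ring_base) (simp add: mult_gens_def)

lemma scalar_mult_mem_mult_ring: "scalar_mult c \<in> mult_ring S"
  by (rule generated_ring_base) (simp add: mult_gens_def)

lemma mult_ring_scale:
  assumes "f \<in> mult_ring S"
  shows "apply_endo f (c *s v) = c *s apply_endo f v"
  using assms
proof (induction arbitrary: v)
  case (generated_ring_base f)
  then show ?case
    by (auto simp: mult_gens_def scalar_mult.rep_eq left_mult.rep_eq mul_right_simps mult.commute)
qed (simp_all add: apply_endo_simps scale_right_diff_distrib)

lemma mult_ring_invariant:
  assumes "f \<in> mult_ring S" and "ideal_of K UNIV" and "v \<in> K"
  shows "apply_endo f v \<in> K"
  using assms(1,3)
proof (induction arbitrary: v)
  case (generated_ring_base f)
  then show ?case using assms(2)
    by (auto simp: mult_gens_def scalar_mult.rep_eq left_mult.rep_eq ideal_of_def subspace_scale)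
next
  case (generated_ring_diff f g)
  then show ?case using assms(2)
    by (auto simp: apply_endo_simps ideal_of_def subspace_diff)
qed (simp_all add: apply_endo_simps)

text \<open>For an ideal \<open>K\<close> these operators are the ones that vanish on the quotient
  by \<open>K\<close>, so nilpotency modulo this set is nilpotency on the quotient.\<close>

definition maps_into :: "'v set \<Rightarrow> 'v endo set"
  where "maps_into K = {f \<in> mult_ring UNIV. \<forall>v. apply_endo f v \<in> K}"

lemma subring_modulo_maps_into:
  assumes "ideal_of K UNIV"
  shows "subring_modulo (mult_ring UNIV) (maps_into K)"
proof
  show ring: "unital_subring (mult_ring UNIV)" by (rule unital_subring_generated_ring)
  have K: "subspace K" using assms by (simp add: ideal_of_def)
  show "ideal_in (mult_ring UNIV) (maps_into K)"
    unfolding ideal_in_def maps_into_def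
    using unital_subringD[OF ring] mult_ring_invariant[OF _ assms] K
    by (auto simp: apply_endo_simps subspace_0 subspace_diff)
qed

lemma apply_endo_linear:
  assumes "f \<in> mult_ring UNIV" and "subspace T"
  shows "subspace {v. apply_endo f v \<in> T}"
proof -
  have "apply_endo f (x + y) = apply_endo f x + apply_endo f y" for x y
    using apply_endo[of f] by simp
  moreover from this[of 0 0] have "apply_endo f 0 = 0" by simp
  ultimately show ?thesis using assms by (auto simp: subspace_def mult_ring_scale)
qed

text \<open>The subspaces spanned by \<open>K\<close> and the images of \<open>R ^ n\<close>
  decrease, and a repetition among them persists. Nilpotency forces the repeated value to be
  \<open>K\<close>. The bound on the repetition is independent of \<open>K\<close> and
  \<open>R\<close>.\<close>

lemma nilpotency_bound:
  obtains N where "\<And>K R. ideal_of K UNIV \<Longrightarrow> R \<subseteq> mult_ring UNIV \<Longrightarrow>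
    nilpotent_mod (maps_into K) R \<Longrightarrow> R ^ N \<subseteq> maps_into K"
proof -
  obtain N where N: "\<And>W :: nat \<Rightarrow> 'v set. (\<And>i. subspace (W i)) \<Longrightarrow> (\<And>i. W (Suc i) \<subseteq> W i) \<Longrightarrow>
    \<exists>n\<le>N. W (Suc n) = W n" using stabilization_bound by blast
  show thesis
  proof (rule that[of N])
    fix K R
    assume ideal: "ideal_of K UNIV" and R: "R \<subseteq> mult_ring UNIV"
      and nil: "nilpotent_mod (maps_into K) R"
    have K: "subspace K" using ideal by (simp add: ideal_of_def)
    have R_power: "R ^ n \<subseteq> mult_ring UNIV" for n
      using set_power_subset_subring[OF unital_subring_generated_ring R] .
    define W where "W n = span (K \<union> {apply_endo f v | f v. f \<in> R ^ n})" for n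
    have W: "subspace (W n)" for n by (simp add: W_def)
    have KW: "K \<subseteq> W n" for n by (auto simp: W_def intro: span_base)
    have W_mem: "apply_endo f v \<in> W n" if "f \<in> R ^ n" for f v n
      using that unfolding W_def by (intro span_base) blast
    have W_le: "W n \<subseteq> T" if "subspace T" "K \<subseteq> T" "\<And>f v. f \<in> R ^ n \<Longrightarrow> apply_endo f v \<in> T" for n T
      using that unfolding W_def by (intro span_minimal) auto
    have dec: "W (Suc n) \<subseteq> W n" for n
    proof (rule W_le[OF W KW])
      fix f v assume "f \<in> R ^ Suc n"
      then have "f \<in> R ^ n * R" by (simp only: power_Suc2)
      then obtain g h where "f = g * h" "g \<in> R ^ n" by (rule set_times_elim)
      then show "apply_endo f v \<in> W n" using W_mem by (simp add: apply_endo_simps)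
    qed
    have step: "apply_endo f v \<in> W (Suc n)" if "f \<in> R" "v \<in> W n" for f v n
    proof -
      have f: "f \<in> mult_ring UNIV" using that R by blast
      have "W n \<subseteq> {v. apply_endo f v \<in> W (Suc n)}"
      proof (rule W_le)
        show "subspace {v. apply_endo f v \<in> W (Suc n)}" by (rule apply_endo_linear[OF f W])
        show "K \<subseteq> {v. apply_endo f v \<in> W (Suc n)}"
          using mult_ring_invariant[OF f ideal] KW by blast
        fix g u assume "g \<in> R ^ n"
        then have "f * g \<in> R ^ Suc n" using that by auto
        from W_mem[OF this, of u]
        show "apply_endo g u \<in> {v. apply_endo f v \<in> W (Suc n)}" by (simp add: apply_endo_simps)
      qed
      then show ?thesis using that by blast
    qed
    obtain n where n: "n \<le> N" "W (Suc n) = W n" using N[of W, OF W dec] by blast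
    \<comment> \<open>Applying \<open>R\<close> to this inclusion yields
      \<open>W (Suc n) \<subseteq> W (Suc (n + k))\<close>, whose left side is \<open>W n\<close>
      again.\<close>
    have "W n \<subseteq> W (n + k)" for k
    proof (induction k)
      case (Suc k)
      have "W (Suc n) \<subseteq> W (Suc (n + k))"
      proof (rule W_le[OF W KW])
        fix f v assume "f \<in> R ^ Suc n"
        then obtain g h where f: "g \<in> R" "h \<in> R ^ n" "f = g * h" by (rule set_power_Suc_elim)
        have "apply_endo h v \<in> W (n + k)" using W_mem[OF f(2)] Suc by blast
        from step[OF f(1) this] show "apply_endo f v \<in> W (Suc (n + k))"
          by (simp add: f(3) apply_endo_simps)
      qed
      then show ?case using n(2) by simp
    qed simp
    note n_le = this
    obtain k where k: "R ^ k \<subseteq> maps_into K" using nil unfolding nilpotent_mod_def by blast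
    have Wk: "W k \<subseteq> K" using k K by (intro W_le) (auto simp: maps_into_def)
    have antimono: "W j \<subseteq> W i" if "i \<le> j" for i j
      using that by (rule lift_Suc_antimono_le[of W, OF dec])
    have "W N \<subseteq> W n" by (rule antimono[OF n(1)])
    also have "\<dots> \<subseteq> W (n + k)" by (rule n_le)
    also have "\<dots> \<subseteq> W k" by (rule antimono) simp
    also have "\<dots> \<subseteq> K" by (rule Wk)
    finally have "W N \<subseteq> K" .
    then show "R ^ N \<subseteq> maps_into K" using W_mem R_power[of N] by (auto simp: maps_into_def)
  qed
qed

lemma left_mult_power_action_series:
  assumes "f \<in> (left_mult ` B) ^ n"
  shows "apply_endo f v \<in> action_series B n"
  using assms
proof (induction n arbitrary: f)
  case (Suc n)
  from Suc.prems obtain g h where "g \<in> left_mult ` B" "h \<in> (left_mult ` B) ^ n" "f = g * h"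
    by (rule set_power_Suc_elim)
  then show ?case using Suc.IH[of h] mul_action_series
    by (auto simp: apply_endo_simps left_mult.rep_eq simp del: action_series.simps)
qed simp

end

section \<open>Climbing the chain with nilpotent radicals\<close>

context leibniz_algebra_char_0
begin

text \<open>Induction from \<open>c t = B\<close> to \<open>c 0\<close> with
  \<open>subset_nil_radical\<close> at every stage: first for the left multiplications of
  \<open>B\<close>, whose \<open>n\<close>-fold products map into \<open>K\<close>, then for the
  radical of each ring inside the next one.\<close>

lemma left_mult_image_nil_radical:
  assumes "subinvariant B" and K: "ideal_of K UNIV" and n: "action_series B n \<subseteq> K"
  shows "left_mult ` B \<subseteq> nil_radical (maps_into K) (mult_ring UNIV)"
proof -
  interpret subring_modulo "mult_ring UNIV" "maps_into K"
    by (rule subring_modulo_maps_into[OF K])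
  obtain t c where c: "c t = B" "subnormal_chain t c"
    using assms(1) subinvariant_iff_chain by blast
  have B: "subalgebra B" using subnormal_chainD(2)[OF c(2), of t] c(1) by simp
  obtain N where N: "\<And>R. R \<subseteq> mult_ring UNIV \<Longrightarrow> nilpotent_mod (maps_into K) R \<Longrightarrow> R ^ N \<subseteq> maps_into K"
    using nilpotency_bound K by metis
  let ?rad = "\<lambda>i. nil_radical (maps_into K) (mult_ring (c i))"
  have scalar: "scalar_mult a * f = f * scalar_mult a" if "f \<in> mult_ring UNIV" for a f
    by (rule endo_eqI) (simp add: apply_endo_simps scalar_mult.rep_eq mult_ring_scale[OF that])
  have sub: "mult_ring S \<subseteq> mult_ring UNIV" for S by (rule mult_ring_mono) simp
  \<comment> \<open>Characteristic zero enters here: \<open>of_nat n\<close> is invertible in the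
    field.\<close>
  have nat_inverse: "\<exists>u\<in>mult_ring S. u * nat_elt n = 1" if "0 < n" for S n
  proof
    show "scalar_mult (1 / of_nat n) * nat_elt n = 1"
      using that by (simp flip: scalar_mult_of_nat add: scalar_mult_mult scalar_mult_one)
  qed (rule scalar_mult_mem_mult_ring)
  have "left_mult ` B \<subseteq> ?rad i" if "i \<le> t" for i
    using that
  proof (induction rule: inc_induct)
    case base
    have "left_mult ` B \<subseteq> nil_radical (maps_into K) (generated_ring (mult_gens B))"
    proof (rule subset_nil_radical)
      show LB: "left_mult ` B \<subseteq> mult_ring B" using left_mult_mem_mult_ring by blast
      have "(left_mult ` B) ^ n \<subseteq> mult_ring UNIV"
        using set_power_subset_subring[OF unital_subring_generated_ring] LB sub by blast
      then have "(left_mult ` B) ^ n \<subseteq> maps_into K"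
        unfolding maps_into_def using left_mult_power_action_series n by blast
      then show "nilpotent_mod (maps_into K) (left_mult ` B)" unfolding nilpotent_mod_def by blast
      fix x r assume x: "x \<in> mult_gens B" and "r \<in> left_mult ` B"
      then obtain b where b: "b \<in> B" "r = left_mult b" by blast
      consider a where "x = scalar_mult a" | y where "y \<in> B" "x = left_mult y"
        using x by (auto simp: mult_gens_def)
      then show "commutator x r \<in> left_mult ` B"
      proof cases
        case 1
        have "0 \<in> B" using B by (simp add: subalgebra_def subspace_0)
        then have "left_mult 0 \<in> left_mult ` B" by (rule imageI)
        then show ?thesis
          using 1 b(2) scalar[OF left_mult_mem_mult_ring[OF UNIV_I]] by (simp add: left_mult_zero)
      next
        case 2
        then have "y \<cdot> b \<in> B" using B b by (simp add: subalgebra_def)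
        then show ?thesis unfolding 2 b(2) left_mult_mul[symmetric] by (rule imageI)
      qed
    qed (rule sub)
    then show ?case using c(1) by simp
  next
    case (step i)
    have ideal: "ideal_of (c (Suc i)) (c i)" using subnormal_chainD(3)[OF c(2)] step by simp
    let ?E = "mult_ring (c (Suc i))"
    note E = unital_subring_generated_ring[of "mult_gens (c (Suc i))"] sub[of "c (Suc i)"]
    have rad: "ideal_in ?E (?rad (Suc i))" by (rule ideal_nil_radical[OF E])
    have "?rad (Suc i) \<subseteq> nil_radical (maps_into K) (generated_ring (mult_gens (c i)))"
    proof (rule subset_nil_radical)
      have "?E \<subseteq> mult_ring (c i)" using ideal by (intro mult_ring_mono) (simp add: ideal_of_def)
      then show "?rad (Suc i) \<subseteq> mult_ring (c i)" using ideal_inD(1)[OF rad] by blast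
      \<comment> \<open>One exponent must serve the whole union. A product of \<open>N\<close>
        elements lies in the \<open>N\<close>-th power of one nilpotent ideal, for which
        \<open>N\<close> suffices.\<close>
      have "?rad (Suc i) ^ N \<subseteq> maps_into K"
      proof
        fix f assume "f \<in> ?rad (Suc i) ^ N"
        then obtain R where "ideal_in ?E R" "nilpotent_mod (maps_into K) R" "f \<in> R ^ N"
          by (rule nil_radical_power_mem[OF E])
        then show "f \<in> maps_into K" using N[of R] ideal_inD(1)[of ?E R] E(2) by blast
      qed
      then show "nilpotent_mod (maps_into K) (?rad (Suc i))" unfolding nilpotent_mod_def by blast
      fix x r assume x: "x \<in> mult_gens (c i)" and r: "r \<in> ?rad (Suc i)"
      have rU: "r \<in> mult_ring UNIV" using r ideal_inD(1)[OF rad] E(2) by blast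
      consider a where "x = scalar_mult a" | y where "y \<in> c i" "x = left_mult y"
        using x by (auto simp: mult_gens_def)
      then show "commutator x r \<in> ?rad (Suc i)"
      proof cases
        case 1
        then show ?thesis using scalar[OF rU] ideal_inD(2)[OF rad] by simp
      next
        case 2
        \<comment> \<open>The commutator of left multiplications by \<open>y\<close> and
          \<open>z\<close> is that by \<open>y \<cdot> z\<close>, and \<open>c (Suc i)\<close> is an
          ideal of \<open>c i\<close>; so \<open>x\<close> normalises the smaller ring.\<close>
        have "commutator x g \<in> ?E" if g: "g \<in> mult_gens (c (Suc i))" for g
        proof -
          consider a where "g = scalar_mult a" | z where "z \<in> c (Suc i)" "g = left_mult z"
            using g by (auto simp: mult_gens_def)
          then show ?thesis
          proof cases
            case 1
            have "x \<in> mult_ring UNIV" using 2 left_mult_mem_mult_ring by simp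
            then have "commutator x g = 0" using scalar[of x] 1 by simp
            then show ?thesis using unital_subringD(2)[OF E(1)] by simp
          next
            case z: 2
            then have "y \<cdot> z \<in> c (Suc i)" using ideal 2 by (auto simp: ideal_of_def)
            then show ?thesis unfolding 2(2) z(2) left_mult_mul[symmetric]
              by (rule left_mult_mem_mult_ring)
          qed
        qed
        then have "commutator x a \<in> ?E" if "a \<in> ?E" for a
          using commutator_closed_generated_ring that by blast
        moreover have "x \<in> mult_ring UNIV" using 2 left_mult_mem_mult_ring by simp
        ultimately show ?thesis using commutator_nil_radical[OF E] nat_inverse r by blast
      qed
    qed (rule sub)
    then show ?case using step by blast
  qed
  from this[of 0] show ?thesis using subnormal_chainD(1)[OF c(2)] by simp
qed

end

section \<open>Lower central series and subalgebras containing one of its terms\<close>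

context leibniz_algebra
begin

text \<open>The index counts multiplications: term \<open>n\<close> comes from products of
  \<open>n + 1\<close> factors, whence the \<open>Suc\<close> in
  \<open>lower_central_series_mul\<close>.\<close>

primrec lower_central_series :: "'v set \<Rightarrow> nat \<Rightarrow> 'v set"
  where
    "lower_central_series N 0 = N"
  | "lower_central_series N (Suc n) = span {x \<cdot> y | x y. x \<in> N \<and> y \<in> lower_central_series N n}"

lemma mul_lower_central_series_Suc:
  "x \<in> N \<Longrightarrow> y \<in> lower_central_series N n \<Longrightarrow> x \<cdot> y \<in> lower_central_series N (Suc n)"
  by (auto intro: span_base)

lemma lower_central_series_induct:
  assumes "subspace T" and "\<And>x y. x \<in> N \<Longrightarrow> y \<in> lower_central_series N n \<Longrightarrow> x \<cdot> y \<in> T"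
  shows "lower_central_series N (Suc n) \<subseteq> T"
proof -
  have "{x \<cdot> y | x y. x \<in> N \<and> y \<in> lower_central_series N n} \<subseteq> T" using assms(2) by blast
  then show ?thesis using span_minimal assms(1) by simp
qed

lemma subspace_lower_central_series: "subspace N \<Longrightarrow> subspace (lower_central_series N n)"
  by (cases n) auto

lemma lower_central_series_decreasing:
  assumes "subalgebra N"
  shows "lower_central_series N (Suc n) \<subseteq> lower_central_series N n"
proof (induction n)
  case 0
  show ?case
    by (rule lower_central_series_induct) (use assms in \<open>auto simp: subalgebra_def\<close>)
next
  case (Suc n)
  have "subspace (lower_central_series N (Suc n))"
    by (rule subspace_lower_central_series) (use assms in \<open>simp add: subalgebra_def\<close>)
  then show ?case
    by (rule lower_central_series_induct) (use Suc mul_lower_central_series_Suc in blast)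
qed

lemma lower_central_series_subset:
  assumes "subalgebra N"
  shows "lower_central_series N n \<subseteq> N"
  by (induction n) (use lower_central_series_decreasing[OF assms] in \<open>simp, blast\<close>)

text \<open>The series is built by left multiplications only. Rewriting
  \<open>(a \<cdot> b) \<cdot> y\<close> as
  \<open>a \<cdot> (b \<cdot> y) - b \<cdot> (a \<cdot> y)\<close> shows that right multiplication
  by \<open>N\<close> descends as well.\<close>

lemma lower_central_series_mul:
  assumes N: "subspace N"
  shows "x \<in> lower_central_series N m \<Longrightarrow> y \<in> lower_central_series N n \<Longrightarrow>
    x \<cdot> y \<in> lower_central_series N (Suc (m + n))"
proof (induction m arbitrary: x y n)
  case 0
  then show ?case using mul_lower_central_series_Suc by (simp del: lower_central_series.simps(2))
next
  case (Suc m)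
  note sub = subspace_lower_central_series[OF N]
  have "lower_central_series N (Suc m) \<subseteq>
    {x. \<forall>y\<in>lower_central_series N n. x \<cdot> y \<in> lower_central_series N (Suc (Suc m + n))}"
  proof (rule lower_central_series_induct[OF subspace_left_multipliers[OF sub]])
    fix a b assume ab: "a \<in> N" "b \<in> lower_central_series N m"
    have "(a \<cdot> b) \<cdot> y \<in> lower_central_series N (Suc (Suc m + n))"
      if y: "y \<in> lower_central_series N n" for y
    proof -
      have "a \<cdot> (b \<cdot> y) \<in> lower_central_series N (Suc (Suc (m + n)))"
        by (rule mul_lower_central_series_Suc[OF ab(1) Suc.IH[OF ab(2) y]])
      moreover have "b \<cdot> (a \<cdot> y) \<in> lower_central_series N (Suc (m + Suc n))"
        by (rule Suc.IH[OF ab(2) mul_lower_central_series_Suc[OF ab(1) y]])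
      ultimately show ?thesis
        using subspace_diff[OF sub, of _ "Suc (Suc (m + n))"]
        by (simp only: leibniz_left add_Suc add_Suc_right)
    qed
    then show "a \<cdot> b \<in> {x. \<forall>y\<in>lower_central_series N n.
        x \<cdot> y \<in> lower_central_series N (Suc (Suc m + n))}" by blast
  qed
  then show ?case using Suc.prems by blast
qed

text \<open>With \<open>L j\<close> the lower central series, the chain is the whole algebra,
  \<open>N = D + L 0\<close>, \<open>D + L 1\<close>, and so on to
  \<open>D + L m = D\<close>.\<close>

lemma subinvariant_of_nilpotent_mod:
  assumes N: "ideal_of N UNIV" and D: "subalgebra D" "D \<subseteq> N"
    and m: "lower_central_series N m \<subseteq> D"
  shows "subinvariant D"
proof -
  have sN: "subspace N" and aN: "subalgebra N" using N by (auto simp: ideal_of_def subalgebra_def)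
  have sD: "subspace D" and DD: "\<And>x y. x \<in> D \<Longrightarrow> y \<in> D \<Longrightarrow> x \<cdot> y \<in> D"
    using D(1) by (auto simp: subalgebra_def)
  define L where "L = lower_central_series N"
  have L0: "L 0 = N" and sL: "subspace (L j)" and L_dec: "L (Suc j) \<subseteq> L j" and L_N: "L j \<subseteq> N"
    and mul1: "x \<in> L j \<Longrightarrow> y \<in> N \<Longrightarrow> x \<cdot> y \<in> L (Suc j)"
    and mul2: "x \<in> N \<Longrightarrow> y \<in> L j \<Longrightarrow> x \<cdot> y \<in> L (Suc j)" for j x y
    using subspace_lower_central_series[OF sN] lower_central_series_decreasing[OF aN]
      lower_central_series_subset[OF aN] lower_central_series_mul[OF sN, of x j y 0]
      lower_central_series_mul[OF sN, of x 0 y j]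
    by (simp_all add: L_def del: lower_central_series.simps(2))
  define P where "P j = {d + a | d a. d \<in> D \<and> a \<in> L j}" for j
  have sP: "subspace (P j)" for j unfolding P_def by (rule subspace_sums[OF sD sL])
  have P_I: "d + a \<in> P j" if "d \<in> D" "a \<in> L j" for d a j using that by (auto simp: P_def)
  have ideal: "ideal_of (P (Suc j)) (P j)" for j
    unfolding ideal_of_def
  proof (intro conjI ballI)
    show "P (Suc j) \<subseteq> P j" using L_dec unfolding P_def by blast
    fix x y assume "x \<in> P (Suc j)" "y \<in> P j"
    then obtain d a e b where x: "x = d + a" "d \<in> D" "a \<in> L (Suc j)"
      and y: "y = e + b" "e \<in> D" "b \<in> L j" by (auto simp: P_def)
    have dN: "d \<in> N" "e \<in> N" "a \<in> L j" using x y D(2) L_dec by auto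
    have N_add: "e + b \<in> N" "d + a \<in> N"
      using x y dN L_N[of j] L_N[of "Suc j"] subspace_add[OF sN] by auto
    \<comment> \<open>Once the product of the components in \<open>D\<close> is split off, every
      remaining summand has one factor in \<open>L j\<close> and the other in
      \<open>N\<close>.\<close>
    have "d \<cdot> b + a \<cdot> (e + b) \<in> L (Suc j)" "e \<cdot> a + b \<cdot> (d + a) \<in> L (Suc j)"
      by (intro subspace_add[OF sL] mul2[OF dN(1) y(3)] mul2[OF dN(2,3)] mul1[OF dN(3) N_add(1)]
          mul1[OF y(3) N_add(2)])+
    moreover have "x \<cdot> y = d \<cdot> e + (d \<cdot> b + a \<cdot> (e + b))" "y \<cdot> x = e \<cdot> d + (e \<cdot> a + b \<cdot> (d + a))"
      by (simp_all add: x y mul_left_simps mul_right_simps algebra_simps)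
    ultimately show "x \<cdot> y \<in> P (Suc j)" "y \<cdot> x \<in> P (Suc j)" using P_I DD x y by auto
  qed (rule sP)
  have P0: "P 0 = N"
  proof
    show "P 0 \<subseteq> N" using D(2) subspace_add[OF sN] by (auto simp: P_def L0)
    show "N \<subseteq> P 0" using P_I[of 0 _ 0] subspace_0[OF sD] by (auto simp: L0)
  qed
  have Pm: "P m = D"
  proof
    show "P m \<subseteq> D" using m subspace_add[OF sD] by (auto simp: P_def L_def)
    show "D \<subseteq> P m" using P_I[of _ 0 m] subspace_0[OF sL] by auto
  qed
  have aP: "subalgebra (P j)" for j
  proof (cases j)
    case 0
    then show ?thesis using aN P0 by simp
  next
    case (Suc i)
    then show ?thesis using ideal[of i] by (auto simp: ideal_of_def subalgebra_def)
  qed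
  \<comment> \<open>Putting the whole algebra in front shifts the index by one and makes the length
    \<open>Suc m\<close>.\<close>
  define c where "c i = (case i of 0 \<Rightarrow> UNIV | Suc j \<Rightarrow> P j)" for i
  have "subalgebra (c i)" for i
    using aP by (cases i) (auto simp: c_def subalgebra_def subspace_UNIV)
  moreover have "ideal_of (c (Suc i)) (c i)" for i
    using ideal N P0 by (cases i) (auto simp: c_def)
  moreover have "ideal_of (c i) (c (i - 1))" if "i \<in> {1..Suc m}" for i
    using calculation(2)[of "i - 1"] that by simp
  ultimately have "subnormal_chain (Suc m) c" by (simp add: subnormal_chain_def c_def)
  moreover have "c (Suc m) = D" using Pm by (simp add: c_def)
  ultimately show ?thesis using subinvariant_iff_chain by blast
qed

lemma ideal_of_sum:
  assumes I: "ideal_of I UNIV" and J: "ideal_of J UNIV"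
  shows "ideal_of {x + y | x y. x \<in> I \<and> y \<in> J} UNIV" (is "ideal_of ?S UNIV")
proof -
  have "subspace ?S" by (rule subspace_sums) (use I J in \<open>auto simp: ideal_of_def\<close>)
  moreover have "s \<cdot> v \<in> ?S \<and> v \<cdot> s \<in> ?S" if "s \<in> ?S" for s v
  proof -
    obtain x y where s: "s = x + y" "x \<in> I" "y \<in> J" using \<open>s \<in> ?S\<close> by blast
    then have "x \<cdot> v \<in> I" "v \<cdot> x \<in> I" "y \<cdot> v \<in> J" "v \<cdot> y \<in> J" using I J by (auto simp: ideal_of_def)
    then show ?thesis unfolding s(1) mul_left_simps mul_right_simps by blast
  qed
  ultimately show ?thesis by (simp add: ideal_of_def)
qed

lemma subalgebra_generated: "subalgebra (generated_subalgebra X)"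
  unfolding generated_subalgebra_def
  by (rule hull_in) (auto simp: subalgebra_def intro!: subspace_Inter)

text \<open>A nested product \<open>x1 \<cdot> (... (xm \<cdot> y))\<close> is the value at
  \<open>y\<close> of a product of \<open>m\<close> left multiplications; the induction moves them
  from the vector to the operator.\<close>

lemma nilpotent_lower_central_series:
  assumes K: "ideal_of K UNIV" and nil: "(left_mult ` N) ^ m \<subseteq> maps_into K"
  shows "lower_central_series N m \<subseteq> K"
proof -
  have sK: "subspace K" using K by (simp add: ideal_of_def)
  have LU: "left_mult ` N \<subseteq> mult_ring UNIV" using left_mult_mem_mult_ring by blast
  have "apply_endo f v \<in> K"
    if "f \<in> (left_mult ` N) ^ i" "v \<in> lower_central_series N j" "i + j = m" for f v i j
    using that
  proof (induction j arbitrary: f v i)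
    case 0
    then show ?case using nil by (auto simp: maps_into_def)
  next
    case (Suc j)
    have f: "f \<in> mult_ring UNIV"
      using Suc.prems(1) set_power_subset_subring[OF unital_subring_generated_ring LU] by blast
    have "lower_central_series N (Suc j) \<subseteq> {v. apply_endo f v \<in> K}"
    proof (rule lower_central_series_induct[OF apply_endo_linear[OF f sK]])
      fix x y assume xy: "x \<in> N" "y \<in> lower_central_series N j"
      have "f * left_mult x \<in> (left_mult ` N) ^ i * left_mult ` N" using xy Suc.prems by blast
      then have "f * left_mult x \<in> (left_mult ` N) ^ Suc i" by (simp only: power_Suc2)
      from Suc.IH[OF this xy(2)] Suc.prems(3) show "x \<cdot> y \<in> {v. apply_endo f v \<in> K}"
        by (simp add: apply_endo_simps left_mult.rep_eq)
    qed
    then show ?case using Suc.prems(2) by blast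
  qed
  from this[of 1 0 _ m] show ?thesis by (auto simp: apply_endo_simps set_one)
qed

end

section \<open>The join of two subinvariant subalgebras\<close>

context leibniz_algebra_char_0
begin

theorem subinvariant_join:
  assumes B: "subinvariant B" and C: "subinvariant C"
  shows "subinvariant (generated_subalgebra (B \<union> C))"
proof -
  obtain n where I: "ideal_of (action_series B n) UNIV" "action_series B n \<subseteq> B"
    using action_series_residual[OF B] .
  obtain k where J: "ideal_of (action_series C k) UNIV" "action_series C k \<subseteq> C"
    using action_series_residual[OF C] .
  \<comment> \<open>The sum of the residuals is one ideal modulo which both \<open>B\<close> and
    \<open>C\<close> act nilpotently, so a single radical receives both.\<close>
  define K where "K = {x + y | x y. x \<in> action_series B n \<and> y \<in> action_series C k}"
  have K: "ideal_of K UNIV" unfolding K_def by (rule ideal_of_sum[OF I(1) J(1)])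
  have sK: "subspace K" using K by (simp add: ideal_of_def)
  have IK: "action_series B n \<subseteq> K" "action_series C k \<subseteq> K"
    unfolding K_def using subspace_0[OF subspace_action_series] add_0_left add_0_right by force+
  interpret subring_modulo "mult_ring UNIV" "maps_into K"
    by (rule subring_modulo_maps_into[OF K])
  let ?E = "mult_ring UNIV" and ?rad = "nil_radical (maps_into K) (mult_ring UNIV)"
  have rad: "ideal_in ?E ?rad" by (rule ideal_nil_radical[OF subring0 order_refl])
  note radD = ideal_inD[OF rad]
  \<comment> \<open>This preimage of the radical is an ideal because \<open>left_mult\<close> turns
    products into commutators.\<close>
  define N where "N = {x. left_mult x \<in> ?rad}"
  have BN: "B \<subseteq> N" "C \<subseteq> N"
    using left_mult_image_nil_radical[OF B K IK(1)] left_mult_image_nil_radical[OF C K IK(2)]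
    by (auto simp: N_def)
  have lm: "left_mult x \<in> ?E" for x by (rule left_mult_mem_mult_ring) simp
  have N: "ideal_of N UNIV"
    unfolding ideal_of_def
  proof (intro conjI ballI)
    have "x + y \<in> N" if "x \<in> N" "y \<in> N" for x y
    proof -
      have "left_mult (x + y) = left_mult x + left_mult y"
        using left_mult_diff[of "x + y" y] by simp
      then show ?thesis using that radD(4) by (simp add: N_def)
    qed
    then show "subspace N"
      using radD(2,5) scalar_mult_mem_mult_ring
      by (auto simp: subspace_def N_def left_mult_zero left_mult_scale)
    show "x \<cdot> y \<in> N" "y \<cdot> x \<in> N" if "x \<in> N" for x y
      using that radD(3,5,6) lm by (auto simp: N_def left_mult_mul)
  qed simp
  obtain M where M: "\<And>K R. ideal_of K UNIV \<Longrightarrow> R \<subseteq> ?E \<Longrightarrow> nilpotent_mod (maps_into K) R \<Longrightarrow>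
    R ^ M \<subseteq> maps_into K" using nilpotency_bound by blast
  have "?rad ^ M \<subseteq> maps_into K"
  proof
    fix f assume "f \<in> ?rad ^ M"
    then obtain R where "ideal_in ?E R" "nilpotent_mod (maps_into K) R" "f \<in> R ^ M"
      by (rule nil_radical_power_mem[OF subring0 order_refl])
    then show "f \<in> maps_into K" using M[OF K] ideal_inD(1)[of ?E R] by blast
  qed
  moreover have "(left_mult ` N) ^ M \<subseteq> ?rad ^ M" by (rule set_power_mono) (auto simp: N_def)
  ultimately have LK: "lower_central_series N M \<subseteq> K"
    by (intro nilpotent_lower_central_series[OF K]) simp
  let ?D = "generated_subalgebra (B \<union> C)"
  have D: "subalgebra ?D" by (rule subalgebra_generated)
  have BC: "B \<union> C \<subseteq> ?D" unfolding generated_subalgebra_def by (rule hull_subset)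
  have "K \<subseteq> ?D"
    using I(2) J(2) BC D unfolding K_def subalgebra_def by (auto intro!: subspace_add)
  moreover have "?D \<subseteq> N"
    unfolding generated_subalgebra_def
    by (rule hull_minimal) (use BN N in \<open>auto simp: subalgebra_def ideal_of_def\<close>)
  ultimately show ?thesis using subinvariant_of_nilpotent_mod[OF N D] LK by blast
qed

end

theorem theorem3p12:
  fixes scale :: "'f::field_char_0 \<Rightarrow> 'v::ab_group_add \<Rightarrow> 'v"
    and mul :: "'v \<Rightarrow> 'v \<Rightarrow> 'v"
    and B C :: "'v set"
  assumes "leibniz_algebra scale mul"
    and "leibniz_algebra.subinvariant scale mul B"
    and "leibniz_algebra.subinvariant scale mul C"
  shows "leibniz_algebra.subinvariant scale mul
           (leibniz_algebra.generated_subalgebra scale mul (B \<union> C))"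
proof -
  interpret leibniz_algebra_char_0 scale mul
    using assms(1) by (rule leibniz_algebra_char_0.intro)
  show ?thesis using subinvariant_join assms(2,3) .
qed

end
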